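(* Let $m\ge 2$, $n,\ell\ge 1$ be integers, let $\Omega:\mathbb{R}^n\rightrightarrows\mathbb{R}^\ell$ be a closed-valued set-valued mapping, for each $\omega\in\mathbb{R}^\ell$ let $\mathcal{B}(\omega)$ be a real tensor of order $m$ and dimension $n$, and let $p:\mathbb{R}^\ell\to\mathbb{R}^n$ be a mapping. Suppose there exists $v\in\mathbb{R}^n$ such that $$v\ge 0,\qquad \mathcal{B}(\omega)v^{m-1}>0\quad\text{for some }\omega\in\bigcap_{\bar N\in N_\infty}\ \bigcup_{k\in\bar N}\Omega(kv),$$ and suppose that $p$ is bounded below. Then the set-valued tensor complementarity problem SVTCP$(\mathcal{B}(\omega),p(\omega),\Omega)$ is feasible.
   Context: A real tensor of order $m$ and dimension $n$ is an array $\mathcal{B}=(b_{i_1\ldots i_m})$ of real numbers with $i_j\in\{1,\ldots,n\}$. For $v\in\mathbb{R}^n$, $\mathcal{B}v^{m-1}\in\mathbb{R}^n$ is the vector with components $(\mathcal{B}v^{m-1})_i=\sum_{i_2,\ldots,i_m=1}^n b_{i i_2\ldots i_m}v_{i_2}\cdots v_{i_m}$. Vector inequalities are componentwise; $e=(1,\ldots,1)^T\in\mathbb{R}^n$. A set-valued mapping $\Omega:\mathbb{R}^n\rightrightarrows\mathbb{R}^\ell$ assigns to each $v\in\mathbb{R}^n$ a subset $\Omega(v)\subseteq\mathbb{R}^\ell$; it is closed-valued if every $\Omega(v)$ is closed. $N_\infty=\bigcup_{j=1}^\infty\{\{j,j+1,\ldots\}\}$ is the collection of all tails of the positive integers. SVTCP$(\mathcal{B}(\omega),p(\omega),\Omega)$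 is the problem: find $v\in\mathbb{R}^n$ such that $v\ge 0$, $\mathcal{B}(\omega)v^{m-1}+p(\omega)\ge 0$, $v^T(\mathcal{B}(\omega)v^{m-1}+p(\omega))=0$ for some $\omega\in\Omega(v)$. It is feasible if there exist $v\in\mathbb{R}^n$ and $\omega\in\Omega(v)$ with $v\ge 0$ and $\mathcal{B}(\omega)v^{m-1}+p(\omega)\ge 0$. The mapping $p$ is bounded below if there is $\gamma\in\mathbb{R}$ with $p(\omega)\ge\gamma e$ for all $\omega\in\mathbb{R}^\ell$. *)

theory Defs
  imports "HOL-Analysis.Analysis"
begin

text \<open>
  An array with real entries, indexed by lists over the finite type of coordinates.  A tensor of
  order \<open>m\<close> is such an array read at the index lists \<open>[i\<^sub>1, \<dots>, i\<^sub>m]\<close> of length \<open>m\<close> only; its values at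
  lists of any other length are irrelevant.
\<close>

type_synonym 'n tensor = "'n list \<Rightarrow> real"

text \<open>The vector $B v^{m-1}$; the list \<open>js\<close> is $[i_2, \ldots, i_m]$.\<close>

definition tensor_apply :: "nat \<Rightarrow> 'n::finite tensor \<Rightarrow> real ^ 'n \<Rightarrow> real ^ 'n" where
  "tensor_apply m B v =
     (\<chi> i. \<Sum>js | length js = m - 1. B (i # js) * (\<Prod>j\<leftarrow>js. v $ j))"

definition closed_valued :: "(real ^ 'n::finite \<Rightarrow> (real ^ 'l::finite) set) \<Rightarrow> bool" where
  "closed_valued \<Omega> \<longleftrightarrow> (\<forall>v. closed (\<Omega> v))"

definition N_infinity :: "nat set set" where
  "N_infinity = {{j..} | j. 1 \<le> j}"

text \<open>The numeral \<open>1\<close> in \<open>real ^ 'n\<close> is the all-ones vector, and \<open>\<le>\<close> is componentwise.\<close>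

definition bounded_below_map :: "(real ^ 'l::finite \<Rightarrow> real ^ 'n::finite) \<Rightarrow> bool" where
  "bounded_below_map p \<longleftrightarrow> (\<exists>\<gamma>::real. \<forall>\<omega>. \<gamma> *\<^sub>R 1 \<le> p \<omega>)"

definition svtcp_feasible ::
  "nat \<Rightarrow> (real ^ 'l::finite \<Rightarrow> 'n::finite tensor) \<Rightarrow> (real ^ 'l \<Rightarrow> real ^ 'n)
    \<Rightarrow> (real ^ 'n \<Rightarrow> (real ^ 'l) set) \<Rightarrow> bool" where
  "svtcp_feasible m B p \<Omega> \<longleftrightarrow>
     (\<exists>v. \<exists>\<omega>\<in>\<Omega> v. 0 \<le> v \<and> 0 \<le> tensor_apply m (B \<omega>) v + p \<omega>)"

text \<open>
  The library's strict order on \<open>real ^ 'n\<close> only means \<open>\<le>\<close> together with \<open>\<noteq>\<close>, so a strict vector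
  inequality is written with an explicit quantifier over the components.
\<close>

definition strictly_positive :: "real ^ 'n::finite \<Rightarrow> bool" where
  "strictly_positive x \<longleftrightarrow> (\<forall>i. 0 < x $ i)"

end

theory Submission
  imports Defs
begin

text \<open>
  The point \<open>\<omega>\<close> lies in \<open>\<Omega> (k v)\<close> for arbitrarily large \<open>k\<close>. By homogeneity of degree \<open>m - 1 \<ge> 1\<close>,
  $B(\omega)(kv)^{m-1} = k^{m-1} B(\omega)v^{m-1}$ grows at least linearly in \<open>k\<close> in every component,
  so for large \<open>k\<close> it dominates the lower bound of \<open>p\<close>, and \<open>k v\<close> is feasible.
\<close>

lemma prod_list_map_mult_const:
  fixes c :: "'a::comm_monoid_mult"
  shows "(\<Prod>x\<leftarrow>xs. c * f x) = c ^ length xs * (\<Prod>x\<leftarrow>xs. f x)"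
  by (induction xs) (simp_all add: mult_ac)

text \<open>Each summand contains exactly \<open>m - 1\<close> factors from \<open>v\<close>, so
  \<open>c ^ (m - 1)\<close> comes out of the whole sum.\<close>

lemma tensor_apply_scaleR:
  "tensor_apply m B (c *\<^sub>R v) = c ^ (m - 1) *\<^sub>R tensor_apply m B v"
  by (simp add: tensor_apply_def vec_eq_iff prod_list_map_mult_const sum_distrib_left mult_ac)

text \<open>The index type is finite, so the least component is attained and hence positive.\<close>

lemma strictly_positive_lower_bound:
  assumes "strictly_positive x"
  obtains c where "c > 0" "\<And>i. c \<le> x $ i"
proof
  show "Min (range (($) x)) > 0"
    using assms by (simp add: strictly_positive_def)
  show "Min (range (($) x)) \<le> x $ i" for i
    by simp
qed

theorem theorem3p2:
  fixes m :: nat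
    and \<Omega> :: "real ^ 'n::finite \<Rightarrow> (real ^ 'l::finite) set"
    and B :: "real ^ 'l \<Rightarrow> 'n tensor"
    and p :: "real ^ 'l \<Rightarrow> real ^ 'n"
  assumes "m \<ge> 2"
    and "closed_valued \<Omega>"
    and "\<exists>v. 0 \<le> v \<and>
           (\<exists>\<omega> \<in> (\<Inter>N\<in>N_infinity. \<Union>k\<in>N. \<Omega> (real k *\<^sub>R v)).
              strictly_positive (tensor_apply m (B \<omega>) v))"
    and "bounded_below_map p"
  shows "svtcp_feasible m B p \<Omega>"
proof -
  obtain v \<omega> where v: "0 \<le> v"
    and \<omega>: "\<omega> \<in> (\<Inter>N\<in>N_infinity. \<Union>k\<in>N. \<Omega> (real k *\<^sub>R v))"
    and pos: "strictly_positive (tensor_apply m (B \<omega>) v)"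
    using assms(3) by blast
  obtain \<gamma> where \<gamma>: "\<gamma> *\<^sub>R 1 \<le> p \<omega>"
    using assms(4) by (auto simp: bounded_below_map_def)
  obtain c where c: "c > 0" "\<And>i. c \<le> tensor_apply m (B \<omega>) v $ i"
    using strictly_positive_lower_bound[OF pos] by blast
  \<comment> \<open>As \<open>c\<close> bounds all components at once, one threshold
    \<open>K\<close> serves every \<open>i\<close>.\<close>
  obtain K where K: "- \<gamma> < real K * c"
    using reals_Archimedean3[OF c(1)] by blast
  \<comment> \<open>\<open>K\<close> may be 0 when \<gamma> > 0. The maximum with 1 keeps this a
    tail of the positive integers and gives \<open>k \<ge> 1\<close>.\<close>
  have "{max 1 K..} \<in> N_infinity"
    by (auto simp: N_infinity_def)
  with \<omega> obtain k where k: "k \<ge> 1" "k \<ge> K" and \<omega>k: "\<omega> \<in> \<Omega> (real k *\<^sub>R v)"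
    by fastforce
  have "0 \<le> (tensor_apply m (B \<omega>) (real k *\<^sub>R v) + p \<omega>) $ i" for i
  proof -
    have "real K * c \<le> real k * c"
      using k c by simp
    \<comment> \<open>Since \<open>k \<ge> 1\<close> and \<open>m - 1 \<ge> 1\<close>, the power is
      at least \<open>k\<close>.\<close>
    also have "\<dots> \<le> real k ^ (m - 1) * tensor_apply m (B \<omega>) v $ i"
      using k c \<open>m \<ge> 2\<close> by (intro mult_mono self_le_power) auto
    finally have "- \<gamma> \<le> tensor_apply m (B \<omega>) (real k *\<^sub>R v) $ i"
      using K by (simp add: tensor_apply_scaleR)
    moreover have "\<gamma> \<le> p \<omega> $ i"
      using \<gamma> by (simp add: less_eq_vec_def)
    ultimately show ?thesis
      by simp
  qed
  then have "0 \<le> tensor_apply m (B \<omega>) (real k *\<^sub>R v) + p \<omega>"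
    by (simp add: less_eq_vec_def)
  moreover have "0 \<le> real k *\<^sub>R v"
    using v by (simp add: less_eq_vec_def)
  ultimately show ?thesis
    using \<omega>k unfolding svtcp_feasible_def by blast
qed

end
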